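(* Let $(G,\mathsf{ConjEvenParity}(\alpha_1,\dots,\alpha_k))$ be a generalized parity game with priority functions $\alpha_\ell:V\to[d_\ell]$, $\ell\in\{1,\dots,k\}$. (1) Let $p=(p_1,\dots,p_k)$, with $p_\ell\in[d_\ell]$, be a vector of $0$-priorities. For all $\ell$, let $U_\ell=\{v\in V\mid\alpha_\ell(v)=p_\ell\}$. Let $U'=\{v\in V\mid\exists\ell,\ \alpha_\ell(v)\text{ is a }1\text{-priority and }\alpha_\ell(v)>p_\ell\}$. For all $v_0\in V$, $$v_0\in\mathsf{Win}(G,0,\mathsf{GenB\ddot{u}chi}(U_1,\dots,U_k)\cap\mathsf{CoB\ddot{u}chi}(U'))\implies v_0\in\mathsf{Win}(G,0,\mathsf{ConjEvenParity}(\alpha_1,\dots,\alpha_k)).$$ (2) Let $\ell\in\{1,\dots,k\}$ and let $p_\ell\in[d_\ell]$ be a $1$-priority. Let $U=\{v\in V\mid\alpha_\ell(v)=p_\ell\}$ and $U'=\{v\in V\mid\alpha_\ell(v)\text{ is a }0\text{-priority and }\alpha_\ell(v)>p_\ell\}$. For all $v_0\in V$, $$v_0\in\mathsf{Win}(G,1,\mathsf{B\ddot{u}chi}(U)\cap\mathsf{CoB\ddot{u}chi}(U'))\implies v_0\in\mathsf{Win}(G,1,\mathsf{DisjOddParity}(\alpha_1,\dots,\alpha_k)).$$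
   Context: A game structure $G=(V_0,V_1,E)$ consists of a finite directed graph $(V,E)$ with $V=V_0\sqcup V_1$ ($V_i$ controlled by player $i$) in which every vertex has an outgoing edge. Plays are infinite paths; $\mathsf{Inf}(\pi)$ is the set of vertices occurring infinitely often in $\pi$. A strategy of player $i$ maps each history (finite path) ending in $V_i$ to a successor of its last vertex. For a set of plays $\Omega$, $\mathsf{Win}(G,i,\Omega)$ is the set of vertices $v_0$ from which player $i$ has a strategy such that all plays from $v_0$ consistent with it belong to $\Omega$. $[d]=\{0,1,\dots,d\}$; $k\ge 1$. A $0$-priority is an even number, a $1$-priority an odd number. $\mathsf{EvenParity}(\alpha)$ (resp. $\mathsf{OddParity}(\alpha)$) is the set of plays $\pi$ such that $\max_{v\in\mathsf{Inf}(\pi)}\alpha(v)$ is even (resp. odd). $\mathsf{ConjEvenParity}(\alpha_1,\dots,\alpha_k)=\bigcap_{\ell=1}^k\mathsf{EvenParity}(\alpha_\ell)$ is the objective of player 0 and $\mathsf{DisjOddParity}(\alpha_1,\dots,\alpha_k)=\bigcup_{\ell=1}^k\mathsf{OddParity}(\alpha_\ell)$ is that of player 1. $\mathsf{B\ddot{u}chi}(U)$ is the set of plays $\pi$ with $\mathsf{Inf}(\pi)\cap U\neq\emptyset$; $\mathsf{CoB\ddot{u}chi}(U')$ is the set of plays $\pi$ with $\mathsf{Inf}(\pi)\cap U'=\emptyset$; $\mathsf{GenB\ddot{u}chi}(U_1,\dots,U_k)=\bigcap_{\ell=1}^k\mathsf{B\ddot{u}chi}(U_\ell)$. *)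

theory Defs
  imports Main "HOL-Library.FuncSet" "HOL-Library.Omega_Words_Fun"
begin

datatype player = Player0 | Player1

record 'v game =
  owned :: "player \<Rightarrow> 'v set"
  edges :: "('v \<times> 'v) set"

definition vertices :: "'v game \<Rightarrow> 'v set" where
  "vertices G = owned G Player0 \<union> owned G Player1"

locale game_structure =
  fixes G :: "'v game"
  assumes finite_vertices: "finite (vertices G)"
    and disjoint: "owned G Player0 \<inter> owned G Player1 = {}"
    and edges_subset: "edges G \<subseteq> vertices G \<times> vertices G"
    and outgoing: "\<And>v. v \<in> vertices G \<Longrightarrow> \<exists>w. (v, w) \<in> edges G"

definition plays :: "'v game \<Rightarrow> 'v word set" where
  "plays G = {\<pi>. \<forall>n. \<pi> n \<in> vertices G \<and> (\<pi> n, \<pi> (Suc n)) \<in> edges G}"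

definition histories :: "'v game \<Rightarrow> 'v list set" where
  "histories G = {h. h \<noteq> [] \<and> set h \<subseteq> vertices G \<and> successively (\<lambda>v w. (v, w) \<in> edges G) h}"

(* Strategies are total functions on lists; only their values on histories ending in
   a vertex of the player are constrained, and only these values matter for consistency. *)

definition strategies :: "'v game \<Rightarrow> player \<Rightarrow> ('v list \<Rightarrow> 'v) set" where
  "strategies G i = {\<sigma>. \<forall>h \<in> histories G. last h \<in> owned G i \<longrightarrow> (last h, \<sigma> h) \<in> edges G}"

(* The word \<pi> restricted to its first n + 1 letters is the history \<pi> 0, ..., \<pi> n. *)

definition consistent :: "'v game \<Rightarrow> player \<Rightarrow> ('v list \<Rightarrow> 'v) \<Rightarrow> 'v word \<Rightarrow> bool" where
  "consistent G i \<sigma> \<pi> \<longleftrightarrow> (\<forall>n. \<pi> n \<in> owned G i \<longrightarrow> \<pi> (Suc n) = \<sigma> (prefix (Suc n) \<pi>))"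

definition Win :: "'v game \<Rightarrow> player \<Rightarrow> 'v word set \<Rightarrow> 'v set" where
  "Win G i \<Omega> = {v\<^sub>0 \<in> vertices G. \<exists>\<sigma> \<in> strategies G i.
     \<forall>\<pi> \<in> plays G. \<pi> 0 = v\<^sub>0 \<and> consistent G i \<sigma> \<pi> \<longrightarrow> \<pi> \<in> \<Omega>}"

(* The set of letters occurring infinitely often in a word \<pi> is limit \<pi>.
   For plays of a game structure it is finite and nonempty, so Max is the true maximum. *)

definition EvenParity :: "'v game \<Rightarrow> ('v \<Rightarrow> nat) \<Rightarrow> 'v word set" where
  "EvenParity G \<alpha> = {\<pi> \<in> plays G. even (Max (\<alpha> ` limit \<pi>))}"

definition OddParity :: "'v game \<Rightarrow> ('v \<Rightarrow> nat) \<Rightarrow> 'v word set" where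
  "OddParity G \<alpha> = {\<pi> \<in> plays G. odd (Max (\<alpha> ` limit \<pi>))}"

definition Buchi :: "'v game \<Rightarrow> 'v set \<Rightarrow> 'v word set" where
  "Buchi G U = {\<pi> \<in> plays G. limit \<pi> \<inter> U \<noteq> {}}"

definition CoBuchi :: "'v game \<Rightarrow> 'v set \<Rightarrow> 'v word set" where
  "CoBuchi G U = {\<pi> \<in> plays G. limit \<pi> \<inter> U = {}}"

(* Families are indexed by 1, ..., k with k \<ge> 1 *)

definition GenBuchi :: "'v game \<Rightarrow> nat \<Rightarrow> (nat \<Rightarrow> 'v set) \<Rightarrow> 'v word set" where
  "GenBuchi G k U = (\<Inter>l\<in>{1..k}. Buchi G (U l))"

definition ConjEvenParity :: "'v game \<Rightarrow> nat \<Rightarrow> (nat \<Rightarrow> 'v \<Rightarrow> nat) \<Rightarrow> 'v word set" where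
  "ConjEvenParity G k \<alpha> = (\<Inter>l\<in>{1..k}. EvenParity G (\<alpha> l))"

definition DisjOddParity :: "'v game \<Rightarrow> nat \<Rightarrow> (nat \<Rightarrow> 'v \<Rightarrow> nat) \<Rightarrow> 'v word set" where
  "DisjOddParity G k \<alpha> = (\<Union>l\<in>{1..k}. OddParity G (\<alpha> l))"

end

theory Submission
  imports Defs
begin

text \<open>
  Winning is monotone in the objective, so it suffices to compare objectives play by play. The
  priority \<open>p\<close> is seen infinitely often, and every larger priority seen infinitely often has the
  parity of \<open>p\<close>; hence so does the maximal one.
\<close>

lemma Win_mono: "\<Omega> \<subseteq> \<Omega>' \<Longrightarrow> Win G i \<Omega> \<subseteq> Win G i \<Omega>'"
  unfolding Win_def by blast

text \<open>Needed twice: it makes limits of plays finite, and it puts a limit vertex into the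
  vertex-restricted sets \<open>{v \<in> vertices G. ...}\<close> that the CoBuchi condition
  excludes.\<close>

lemma limit_subset_vertices: "\<pi> \<in> plays G \<Longrightarrow> limit \<pi> \<subseteq> vertices G"
  using limit_in_range[of \<pi>] unfolding plays_def by blast

text \<open>The maximum is attained, at a value at least \<open>f x\<close>: either it is
  \<open>f x\<close> itself, or it is larger and the hypothesis fixes its parity. Stating this as an
  equivalence of parities serves both players.\<close>

lemma even_Max_image_iff:
  fixes f :: "'a \<Rightarrow> nat"
  assumes "finite A" and "x \<in> A" and "\<And>y. y \<in> A \<Longrightarrow> f y > f x \<Longrightarrow> even (f y) \<longleftrightarrow> even (f x)"
  shows "even (Max (f ` A)) \<longleftrightarrow> even (f x)"
proof -
  have "f x \<le> Max (f ` A)"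
    using assms by simp
  moreover have "Max (f ` A) \<in> f ` A"
    using assms by (intro Max_in) auto
  ultimately show ?thesis
    using assms(3) by (metis imageE le_neq_implies_less)
qed

context game_structure
begin

text \<open>Finiteness of the game graph is used here; it guarantees that \<open>Max\<close> is
  attained on the priorities seen infinitely often.\<close>

lemma finite_limit: "\<pi> \<in> plays G \<Longrightarrow> finite (limit \<pi>)"
  using limit_subset_vertices finite_vertices by (rule finite_subset)

lemma Buchi_CoBuchi_subset_EvenParity:
  assumes "even p"
  shows "Buchi G {v \<in> vertices G. \<alpha> v = p} \<inter> CoBuchi G {v \<in> vertices G. odd (\<alpha> v) \<and> \<alpha> v > p}
    \<subseteq> EvenParity G \<alpha>"
proof
  fix \<pi>
  assume *: "\<pi> \<in> Buchi G {v \<in> vertices G. \<alpha> v = p}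
    \<inter> CoBuchi G {v \<in> vertices G. odd (\<alpha> v) \<and> \<alpha> v > p}"
  then have play: "\<pi> \<in> plays G"
    unfolding Buchi_def by blast
  from * obtain x where x: "x \<in> limit \<pi>" "\<alpha> x = p"
    unfolding Buchi_def by blast
  \<comment> \<open>A limit vertex with priority above \<open>p\<close> cannot be odd, since it
    would lie in the set that the CoBuchi condition excludes; so it is even, like
    \<open>\<alpha> x = p\<close>.\<close>
  have "even (Max (\<alpha> ` limit \<pi>)) \<longleftrightarrow> even (\<alpha> x)"
    using * x assms limit_subset_vertices[OF play] unfolding CoBuchi_def
    by (intro even_Max_image_iff finite_limit play) auto
  then show "\<pi> \<in> EvenParity G \<alpha>"
    using assms x play unfolding EvenParity_def by simp
qed

lemma Buchi_CoBuchi_subset_OddParity: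
  assumes "odd p"
  shows "Buchi G {v \<in> vertices G. \<alpha> v = p} \<inter> CoBuchi G {v \<in> vertices G. even (\<alpha> v) \<and> \<alpha> v > p}
    \<subseteq> OddParity G \<alpha>"
proof
  fix \<pi>
  assume *: "\<pi> \<in> Buchi G {v \<in> vertices G. \<alpha> v = p}
    \<inter> CoBuchi G {v \<in> vertices G. even (\<alpha> v) \<and> \<alpha> v > p}"
  then have play: "\<pi> \<in> plays G"
    unfolding Buchi_def by blast
  from * obtain x where x: "x \<in> limit \<pi>" "\<alpha> x = p"
    unfolding Buchi_def by blast
  \<comment> \<open>Dually, CoBuchi leaves only odd limit priorities above \<open>p\<close>. Here
    \<open>\<alpha> x\<close> is odd, so the equivalence refutes evenness of the maximum.\<close>
  have "even (Max (\<alpha> ` limit \<pi>)) \<longleftrightarrow> even (\<alpha> x)"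
    using * x assms limit_subset_vertices[OF play] unfolding CoBuchi_def
    by (intro even_Max_image_iff finite_limit play) auto
  then show "\<pi> \<in> OddParity G \<alpha>"
    using assms x play unfolding OddParity_def by simp
qed

text \<open>Each priority function can be treated separately, because the excluded set is the union
  over \<open>l\<close> of the sets excluded for the individual functions.\<close>

lemma GenBuchi_CoBuchi_subset_ConjEvenParity:
  assumes "\<And>l. l \<in> {1..k} \<Longrightarrow> even (p l)"
  shows "GenBuchi G k (\<lambda>l. {v \<in> vertices G. \<alpha> l v = p l})
      \<inter> CoBuchi G {v \<in> vertices G. \<exists>l\<in>{1..k}. odd (\<alpha> l v) \<and> \<alpha> l v > p l}
    \<subseteq> ConjEvenParity G k \<alpha>" (is "?L \<subseteq> _")
proof -
  have "?L \<subseteq> EvenParity G (\<alpha> l)" if l: "l \<in> {1..k}" for l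
  proof -
    \<comment> \<open>CoBuchi is antitone in its set: avoiding the union implies avoiding its
      \<open>l\<close>-th part.\<close>
    have "?L \<subseteq> Buchi G {v \<in> vertices G. \<alpha> l v = p l}
      \<inter> CoBuchi G {v \<in> vertices G. odd (\<alpha> l v) \<and> \<alpha> l v > p l}"
      using l unfolding GenBuchi_def CoBuchi_def by blast
    also have "\<dots> \<subseteq> EvenParity G (\<alpha> l)"
      using assms[OF l] by (rule Buchi_CoBuchi_subset_EvenParity)
    finally show ?thesis .
  qed
  then show ?thesis
    unfolding ConjEvenParity_def by blast
qed

text \<open>The objective of player 1 is a union, so a single odd index \<open>l\<close>
  suffices.\<close>

lemma Buchi_CoBuchi_subset_DisjOddParity:
  assumes "l \<in> {1..k}" and "odd q"
  shows "Buchi G {v \<in> vertices G. \<alpha> l v = q}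
      \<inter> CoBuchi G {v \<in> vertices G. even (\<alpha> l v) \<and> \<alpha> l v > q}
    \<subseteq> DisjOddParity G k \<alpha>"
  using Buchi_CoBuchi_subset_OddParity[OF assms(2), of "\<alpha> l"] assms(1)
  unfolding DisjOddParity_def by blast

end

theorem proposition6:
  fixes G :: "'v game" and k :: nat and d :: "nat \<Rightarrow> nat" and \<alpha> :: "nat \<Rightarrow> 'v \<Rightarrow> nat"
  assumes "game_structure G"
    and "k \<ge> 1"
    and "\<forall>l\<in>{1..k}. \<alpha> l \<in> vertices G \<rightarrow> {0..d l}"
  shows "(\<forall>p :: nat \<Rightarrow> nat. (\<forall>l\<in>{1..k}. p l \<in> {0..d l} \<and> even (p l)) \<longrightarrow>
           (\<forall>v\<^sub>0 \<in> vertices G.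
              v\<^sub>0 \<in> Win G Player0
                (GenBuchi G k (\<lambda>l. {v \<in> vertices G. \<alpha> l v = p l})
                 \<inter> CoBuchi G {v \<in> vertices G. \<exists>l\<in>{1..k}. odd (\<alpha> l v) \<and> \<alpha> l v > p l})
              \<longrightarrow> v\<^sub>0 \<in> Win G Player0 (ConjEvenParity G k \<alpha>)))
       \<and> (\<forall>l\<in>{1..k}. \<forall>q\<in>{0..d l}. odd q \<longrightarrow>
           (\<forall>v\<^sub>0 \<in> vertices G.
              v\<^sub>0 \<in> Win G Player1
                (Buchi G {v \<in> vertices G. \<alpha> l v = q}
                 \<inter> CoBuchi G {v \<in> vertices G. even (\<alpha> l v) \<and> \<alpha> l v > q})
              \<longrightarrow> v\<^sub>0 \<in> Win G Player1 (DisjOddParity G k \<alpha>)))"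
proof (intro conjI allI ballI impI, goal_cases)
  case (1 p v\<^sub>0)
  then have "\<And>l. l \<in> {1..k} \<Longrightarrow> even (p l)"
    by blast
  \<comment> \<open>The inclusion of objectives lifts to winning sets because the same strategy wins
    for the larger objective.\<close>
  from Win_mono[OF game_structure.GenBuchi_CoBuchi_subset_ConjEvenParity[OF assms(1) this]] 1(3)
  show ?case ..
next
  case (2 l q v\<^sub>0)
  from Win_mono[OF game_structure.Buchi_CoBuchi_subset_DisjOddParity[OF assms(1) 2(1,3)]] 2(5)
  show ?case ..
qed

end
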